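(* For $f, g \in \mathcal H^n$ put $[f,g]=\frac{1}{2}(f\otimes g + g\otimes f)$. Then for any two weaving fusion frames $\{(\mathcal V_i, v_i)\}_{i=1}^m$ and $\{(\mathcal W_i, w_i)\}_{i=1}^m$ in the $n$-dimensional Hilbert space $\mathcal H^n$, the following are equivalent: (1) $\{(\mathcal V_i, v_i)\}_{i=1}^m$ and $\{(\mathcal W_i, w_i)\}_{i=1}^m$ are phase retrievable weaving fusion frames for $\mathcal H^n$. (2) For every $f, g \in \mathcal H^n$ and for every $\sigma \subset \{1, 2, \dots , m\}$, there exists a constant $\alpha>0$ such that $$\frac{1}{4} \left \{\sum_{i\in \sigma} \left|v_i ^2 \langle P_{\mathcal V_i}g,f \rangle + v_i ^2 \langle P_{\mathcal V_i}f,g \rangle\right|^2 + \sum_{i\in \sigma^c} \left|w_i ^2 \langle P_{\mathcal W_i}g,f \rangle + w_i ^2 \langle P_{\mathcal W_i}f,g \rangle\right|^2 \right\}$$ $$= \sum_{i\in \sigma} \left|v_i ^2 \operatorname{tr}(P_{\mathcal V_i}[f,g])\right|^2 + \sum_{i\in \sigma^c} \left|w_i ^2 \operatorname{tr}(P_{\mathcal W_i}[f,g])\right|^2 \;\geq\; \alpha \,\|[f,g]\|_{1}.$$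
   Context: $\mathcal H^n$ is an $n$-dimensional (real or complex) Hilbert space. For a closed subspace $\mathcal V$, $P_{\mathcal V}$ is the orthogonal projection onto $\mathcal V$. For $f,g\in\mathcal H^n$, $f\otimes g$ is the rank-one operator $x\mapsto\langle x,g\rangle f$, and $\|\cdot\|_1$ is the trace norm. A weighted collection $\{(\mathcal W_i,w_i)\}_{i=1}^m$ consists of closed subspaces $\mathcal W_i$ of $\mathcal H^n$ and real scalars $w_i$; it is a fusion frame for $\mathcal H^n$ if there are constants $0<A\le B<\infty$ with $A\|f\|^2\le \sum_{i=1}^m w_i^2\|P_{\mathcal W_i}f\|^2\le B\|f\|^2$ for all $f\in\mathcal H^n$. Two fusion frames $\{(\mathcal V_i,v_i)\}_{i=1}^m$ and $\{(\mathcal W_i,w_i)\}_{i=1}^m$ are called weaving fusion frames for $\mathcal H^n$ if there are universal constants $0<A\le B<\infty$ such that for every $\sigma\subset\{1,\dots,m\}$ (with $\sigma^c$ its complement in $\{1,\dots,m\}$) and every $f\in\mathcal H^n$, $$A\|f\|^2\le \sum_{i\in\sigma} v_i^2\|P_{\mathcal V_i}f\|^2+\sum_{i\in\sigma^c} w_i^2\|P_{\mathcal W_i}f\|^2\le B\|f\|^2 .$$ Write $f\sim g$ if $g=hf$ for some scalar $h$ with $|h|=1$ (so $h=\pm1$ in the real case), and let $\hat f$ be the class of $f$ in $\hat{\mathcal H^n}=\mathcal H^n/\sim$. For $\sigma\subset\{1,\dots,m\}$ define $\gamma_\sigma:\hat{\mathcal H^n}\to\mathbb R^m$ by $(\gamma_\sigma(\hat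 f))_i=v_i\|P_{\mathcal V_i}f\|$ if $i\in\sigma$ and $(\gamma_\sigma(\hat f))_i=w_i\|P_{\mathcal W_i}f\|$ if $i\in\sigma^c$. The weaving fusion frames $\{(\mathcal V_i,v_i)\}_{i=1}^m$ and $\{(\mathcal W_i,w_i)\}_{i=1}^m$ are called phase retrievable weaving fusion frames if $\gamma_\sigma$ is injective for every $\sigma\subset\{1,\dots,m\}$. *)

theory Defs
  imports "HOL-Analysis.Analysis"
begin

text \<open>
  The scalar field is treated once for the real and the complex case. Every element \<open>a\<close> of an
  instance is a root of \<open>x\<^sup>2 - 2 (kre a) x + \<bar>a\<bar>\<^sup>2\<close>, so an instance is algebraic of degree at most 2
  over the reals: up to isometric isomorphism the only instances are the reals and the complex
  numbers, and the axioms determine \<open>kcnj\<close> and \<open>kre\<close> as conjugation and real part.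
\<close>

class real_or_complex = real_normed_field +
  fixes kcnj :: "'a \<Rightarrow> 'a"
    and kre :: "'a \<Rightarrow> real"
  assumes kcnj_add: "kcnj (a + b) = kcnj a + kcnj b"
    and kcnj_mult: "kcnj (a * b) = kcnj a * kcnj b"
    and kcnj_kcnj: "kcnj (kcnj a) = a"
    and mult_kcnj: "a * kcnj a = (norm a)\<^sup>2 *\<^sub>R 1"
    and add_kcnj: "a + kcnj a = (2 * kre a) *\<^sub>R 1"

instantiation real :: real_or_complex
begin

definition kcnj_real :: "real \<Rightarrow> real" where "kcnj_real a = a"
definition kre_real :: "real \<Rightarrow> real" where "kre_real a = a"

instance
  by standard (simp_all add: kcnj_real_def kre_real_def power2_eq_square)

end

instantiation complex :: real_or_complex
begin

definition kcnj_complex :: "complex \<Rightarrow> complex" where "kcnj_complex a = cnj a"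
definition kre_complex :: "complex \<Rightarrow> real" where "kre_complex a = Re a"

instance
  by standard
    (simp_all only: kcnj_complex_def kre_complex_def complex_cnj_add complex_cnj_mult
      complex_cnj_cnj complex_norm_square complex_add_cnj scaleR_conv_of_real mult_1_right)

end

text \<open>
  An \<open>n\<close>-dimensional Hilbert space over the real or complex numbers. The inner product is linear
  in the first argument. Completeness is automatic in finite dimension.
\<close>

locale fin_dim_hilbert_space = vector_space smul
  for smul :: "'k::real_or_complex \<Rightarrow> 'v::ab_group_add \<Rightarrow> 'v" +
  fixes ip :: "'v \<Rightarrow> 'v \<Rightarrow> 'k"
    and n :: nat
  assumes ip_add_left: "ip (x + y) z = ip x z + ip y z"
    and ip_scale_left: "ip (smul a x) y = a * ip x y"
    and ip_commute: "ip y x = kcnj (ip x y)"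
    and ip_self_nonneg: "0 \<le> kre (ip x x)"
    and ip_self_eq_0: "ip x x = 0 \<Longrightarrow> x = 0"
    and finite_basis: "\<exists>B. finite B \<and> card B = n \<and> independent B \<and> span B = UNIV"

definition nrm :: "('v \<Rightarrow> 'v \<Rightarrow> 'k::real_or_complex) \<Rightarrow> 'v \<Rightarrow> real" where
  "nrm ip x = sqrt (kre (ip x x))"

definition closed_subspace ::
  "('k::real_or_complex \<Rightarrow> 'v::ab_group_add \<Rightarrow> 'v) \<Rightarrow> ('v \<Rightarrow> 'v \<Rightarrow> 'k) \<Rightarrow> 'v set \<Rightarrow> bool" where
  "closed_subspace smul ip U \<longleftrightarrow> module.subspace smul U \<and>
     (\<forall>s x. (\<forall>k::nat. s k \<in> U) \<and> (\<lambda>k. nrm ip (s k - x)) \<longlonglongrightarrow> 0 \<longrightarrow> x \<in> U)"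

definition orth_proj ::
  "('v::ab_group_add \<Rightarrow> 'v \<Rightarrow> 'k::real_or_complex) \<Rightarrow> 'v set \<Rightarrow> 'v \<Rightarrow> 'v" where
  "orth_proj ip U x = (THE y. y \<in> U \<and> (\<forall>z\<in>U. ip (x - y) z = 0))"

definition outer ::
  "('k \<Rightarrow> 'v \<Rightarrow> 'v) \<Rightarrow> ('v \<Rightarrow> 'v \<Rightarrow> 'k) \<Rightarrow> 'v \<Rightarrow> 'v \<Rightarrow> 'v \<Rightarrow> 'v" where
  "outer smul ip f g = (\<lambda>x. smul (ip x g) f)"

definition bracket ::
  "('k::real_or_complex \<Rightarrow> 'v::ab_group_add \<Rightarrow> 'v) \<Rightarrow> ('v \<Rightarrow> 'v \<Rightarrow> 'k) \<Rightarrow> 'v \<Rightarrow> 'v \<Rightarrow> 'v \<Rightarrow> 'v" where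
  "bracket smul ip f g = (\<lambda>x. smul (1/2) (outer smul ip f g x + outer smul ip g f x))"

definition orthonormal_basis ::
  "('k::real_or_complex \<Rightarrow> 'v::ab_group_add \<Rightarrow> 'v) \<Rightarrow> ('v \<Rightarrow> 'v \<Rightarrow> 'k) \<Rightarrow> 'v set \<Rightarrow> bool" where
  "orthonormal_basis smul ip E \<longleftrightarrow> finite E \<and>
     (\<forall>x\<in>E. \<forall>y\<in>E. ip x y = (if x = y then 1 else 0)) \<and> module.span smul E = UNIV"

text \<open>The choice of basis is immaterial for linear operators.\<close>

definition op_trace ::
  "('k::real_or_complex \<Rightarrow> 'v::ab_group_add \<Rightarrow> 'v) \<Rightarrow> ('v \<Rightarrow> 'v \<Rightarrow> 'k) \<Rightarrow> ('v \<Rightarrow> 'v) \<Rightarrow> 'k" where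
  "op_trace smul ip T = (\<Sum>e\<in>(SOME E. orthonormal_basis smul ip E). ip (T e) e)"

definition hadjoint :: "('v \<Rightarrow> 'v \<Rightarrow> 'k) \<Rightarrow> ('v \<Rightarrow> 'v) \<Rightarrow> 'v \<Rightarrow> 'v" where
  "hadjoint ip T = (THE S. \<forall>x y. ip (T x) y = ip x (S y))"

text \<open>Self-adjointness is not implied by nonnegativity of the quadratic form in the real case.\<close>

definition positive_op ::
  "('k::real_or_complex \<Rightarrow> 'v::ab_group_add \<Rightarrow> 'v) \<Rightarrow> ('v \<Rightarrow> 'v \<Rightarrow> 'k) \<Rightarrow> ('v \<Rightarrow> 'v) \<Rightarrow> bool" where
  "positive_op smul ip S \<longleftrightarrow> Vector_Spaces.linear smul smul S \<and>
     (\<forall>x y. ip (S x) y = ip x (S y)) \<and> (\<forall>x. 0 \<le> kre (ip (S x) x))"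

definition abs_op ::
  "('k::real_or_complex \<Rightarrow> 'v::ab_group_add \<Rightarrow> 'v) \<Rightarrow> ('v \<Rightarrow> 'v \<Rightarrow> 'k) \<Rightarrow> ('v \<Rightarrow> 'v) \<Rightarrow> 'v \<Rightarrow> 'v" where
  "abs_op smul ip T = (THE S. positive_op smul ip S \<and> S \<circ> S = hadjoint ip T \<circ> T)"

text \<open>The trace of the positive operator \<open>abs_op\<close> is a nonnegative real scalar, which
  \<open>kre\<close> turns into an element of type \<^typ>\<open>real\<close>.\<close>

definition trace_norm ::
  "('k::real_or_complex \<Rightarrow> 'v::ab_group_add \<Rightarrow> 'v) \<Rightarrow> ('v \<Rightarrow> 'v \<Rightarrow> 'k) \<Rightarrow> ('v \<Rightarrow> 'v) \<Rightarrow> real" where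
  "trace_norm smul ip T = kre (op_trace smul ip (abs_op smul ip T))"

definition fusion_frame ::
  "('k::real_or_complex \<Rightarrow> 'v::ab_group_add \<Rightarrow> 'v) \<Rightarrow> ('v \<Rightarrow> 'v \<Rightarrow> 'k) \<Rightarrow> nat \<Rightarrow>
     (nat \<Rightarrow> 'v set) \<Rightarrow> (nat \<Rightarrow> real) \<Rightarrow> bool" where
  "fusion_frame smul ip m W w \<longleftrightarrow>
     (\<forall>i\<in>{1..m}. closed_subspace smul ip (W i)) \<and>
     (\<exists>A B. 0 < A \<and> A \<le> B \<and>
        (\<forall>f. A * (nrm ip f)\<^sup>2 \<le> (\<Sum>i=1..m. (w i)\<^sup>2 * (nrm ip (orth_proj ip (W i) f))\<^sup>2) \<and>
             (\<Sum>i=1..m. (w i)\<^sup>2 * (nrm ip (orth_proj ip (W i) f))\<^sup>2) \<le> B * (nrm ip f)\<^sup>2))"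

definition weaving_fusion_frames ::
  "('k::real_or_complex \<Rightarrow> 'v::ab_group_add \<Rightarrow> 'v) \<Rightarrow> ('v \<Rightarrow> 'v \<Rightarrow> 'k) \<Rightarrow> nat \<Rightarrow>
     (nat \<Rightarrow> 'v set) \<Rightarrow> (nat \<Rightarrow> real) \<Rightarrow> (nat \<Rightarrow> 'v set) \<Rightarrow> (nat \<Rightarrow> real) \<Rightarrow> bool" where
  "weaving_fusion_frames smul ip m V v W w \<longleftrightarrow>
     fusion_frame smul ip m V v \<and> fusion_frame smul ip m W w \<and>
     (\<exists>A B. 0 < A \<and> A \<le> B \<and>
        (\<forall>\<sigma>\<subseteq>{1..m}. \<forall>f.
           A * (nrm ip f)\<^sup>2
             \<le> (\<Sum>i\<in>\<sigma>. (v i)\<^sup>2 * (nrm ip (orth_proj ip (V i) f))\<^sup>2)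
               + (\<Sum>i\<in>{1..m} - \<sigma>. (w i)\<^sup>2 * (nrm ip (orth_proj ip (W i) f))\<^sup>2) \<and>
           (\<Sum>i\<in>\<sigma>. (v i)\<^sup>2 * (nrm ip (orth_proj ip (V i) f))\<^sup>2)
               + (\<Sum>i\<in>{1..m} - \<sigma>. (w i)\<^sup>2 * (nrm ip (orth_proj ip (W i) f))\<^sup>2)
             \<le> B * (nrm ip f)\<^sup>2))"

definition phase_rel :: "('k::real_or_complex \<Rightarrow> 'v \<Rightarrow> 'v) \<Rightarrow> ('v \<times> 'v) set" where
  "phase_rel smul = {(f, g). \<exists>h. norm h = 1 \<and> g = smul h f}"

definition weave_meas ::
  "('v::ab_group_add \<Rightarrow> 'v \<Rightarrow> 'k::real_or_complex) \<Rightarrow> nat \<Rightarrow>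
     (nat \<Rightarrow> 'v set) \<Rightarrow> (nat \<Rightarrow> real) \<Rightarrow> (nat \<Rightarrow> 'v set) \<Rightarrow> (nat \<Rightarrow> real) \<Rightarrow>
     nat set \<Rightarrow> 'v \<Rightarrow> nat \<Rightarrow> real" where
  "weave_meas ip m V v W w \<sigma> f =
     (\<lambda>i\<in>{1..m}. if i \<in> \<sigma> then v i * nrm ip (orth_proj ip (V i) f) else w i * nrm ip (orth_proj ip (W i) f))"

text \<open>
  The map on phase classes: \<open>weave_meas\<close> is constant on each class in \<open>UNIV // phase_rel smul\<close>,
  and \<open>the_elem\<close> picks this common value. Vectors with \<open>m\<close> real entries are functions on
  \<open>{1..m}\<close>, \<open>undefined\<close> elsewhere.
\<close>

definition weave_gamma ::
  "('v::ab_group_add \<Rightarrow> 'v \<Rightarrow> 'k::real_or_complex) \<Rightarrow> nat \<Rightarrow>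
     (nat \<Rightarrow> 'v set) \<Rightarrow> (nat \<Rightarrow> real) \<Rightarrow> (nat \<Rightarrow> 'v set) \<Rightarrow> (nat \<Rightarrow> real) \<Rightarrow>
     nat set \<Rightarrow> 'v set \<Rightarrow> nat \<Rightarrow> real" where
  "weave_gamma ip m V v W w \<sigma> C = the_elem (weave_meas ip m V v W w \<sigma> ` C)"

definition phase_retrievable_weaving ::
  "('k::real_or_complex \<Rightarrow> 'v::ab_group_add \<Rightarrow> 'v) \<Rightarrow> ('v \<Rightarrow> 'v \<Rightarrow> 'k) \<Rightarrow> nat \<Rightarrow>
     (nat \<Rightarrow> 'v set) \<Rightarrow> (nat \<Rightarrow> real) \<Rightarrow> (nat \<Rightarrow> 'v set) \<Rightarrow> (nat \<Rightarrow> real) \<Rightarrow> bool" where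
  "phase_retrievable_weaving smul ip m V v W w \<longleftrightarrow>
     weaving_fusion_frames smul ip m V v W w \<and>
     (\<forall>\<sigma>\<subseteq>{1..m}. inj_on (weave_gamma ip m V v W w \<sigma>) (UNIV // phase_rel smul))"

end

theory Submission
  imports Defs
begin

text \<open>
  Write \<open>f = x + y\<close> and \<open>g = x - y\<close>. Then \<open>[f, g] = x \<otimes> x - y \<otimes> y\<close>, which vanishes exactly when
  \<open>x \<sim> y\<close>, and \<open>tr (P [f, g]) = Re \<langle>P f, g\<rangle> = \<parallel>P x\<parallel>\<^sup>2 - \<parallel>P y\<parallel>\<^sup>2\<close> for an orthogonal projection \<open>P\<close>. Hence
  the sum of squares in (2) is zero exactly when \<open>\<gamma>\<^sub>\<sigma>\<close> does not separate \<open>x\<close> and \<open>y\<close>. As \<open>\<alpha>\<close> may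
  depend on \<open>f\<close>, \<open>g\<close> and \<open>\<sigma>\<close>, the inequality only says that a vanishing sum forces
  \<open>\<parallel>[f, g]\<parallel>\<^sub>1 = 0\<close>, that is \<open>[f, g] = 0\<close>.
\<close>

section \<open>Scalars\<close>

lemma mult_kcnj': "a * kcnj a = of_real ((norm (a::'k::real_or_complex))\<^sup>2)"
  using mult_kcnj[of a] by (simp add: of_real_def)

lemma add_kcnj': "a + kcnj a = of_real (2 * kre (a::'k::real_or_complex))"
  using add_kcnj[of a] by (simp add: of_real_def)

text \<open>The axioms mention \<open>kre\<close> only doubled and embedded in the scalar field, so
  identities for it are proved in that form and then cancelled.\<close>

lemma of_real_double_cancel:
  assumes "(of_real (2 * a) :: 'k::real_algebra_1) = of_real (2 * b)"
  shows "a = b"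
  using assms unfolding of_real_eq_iff by simp

lemma kcnj_0 [simp]: "kcnj (0::'k::real_or_complex) = 0"
  using kcnj_add[of 0 "0::'k"] by simp

lemma kcnj_of_real [simp]: "kcnj (of_real r :: 'k::real_or_complex) = of_real r"
proof (cases "r = 0")
  case False
  have "of_real r * kcnj (of_real r) = (of_real r * of_real r :: 'k)"
    by (simp add: mult_kcnj' power2_eq_square)
  then show ?thesis using False by simp
qed simp

lemma kcnj_minus [simp]: "kcnj (- a :: 'k::real_or_complex) = - kcnj a"
  using kcnj_add[of a "- a"] by (simp add: eq_neg_iff_add_eq_0 add.commute)

text \<open>Conjugation swaps the factors of \<open>a * kcnj a\<close>, so \<open>a\<close> and
  \<open>kcnj a\<close> have the same squared norm.\<close>

lemma norm_kcnj [simp]: "norm (kcnj a :: 'k::real_or_complex) = norm a"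
proof -
  have "(of_real ((norm (kcnj a))\<^sup>2) :: 'k) = of_real ((norm a)\<^sup>2)"
    using mult_kcnj'[of a] mult_kcnj'[of "kcnj a"] by (simp add: kcnj_kcnj mult.commute)
  then show ?thesis unfolding of_real_eq_iff by (simp add: power2_eq_iff_nonneg)
qed

lemma kre_of_real [simp]: "kre (of_real r :: 'k::real_or_complex) = r"
proof -
  have "(of_real (2 * kre (of_real r :: 'k)) :: 'k) = of_real (2 * r)"
    using add_kcnj'[of "of_real r :: 'k"] by simp
  then show ?thesis by (rule of_real_double_cancel)
qed

lemma kre_0 [simp]: "kre (0::'k::real_or_complex) = 0"
  using kre_of_real[of 0] by simp

lemma kre_add: "kre (a + b :: 'k::real_or_complex) = kre a + kre b"
proof -
  have "(of_real (2 * kre (a + b)) :: 'k) = of_real (2 * (kre a + kre b))"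
    unfolding distrib_left of_real_add add_kcnj'[symmetric] by (simp add: kcnj_add ac_simps)
  then show ?thesis by (rule of_real_double_cancel)
qed

lemma kre_kcnj [simp]: "kre (kcnj a :: 'k::real_or_complex) = kre a"
proof -
  have "(of_real (2 * kre (kcnj a)) :: 'k) = of_real (2 * kre a)"
    using add_kcnj'[of a] add_kcnj'[of "kcnj a"] by (simp add: kcnj_kcnj add.commute)
  then show ?thesis by (rule of_real_double_cancel)
qed

lemma kre_minus [simp]: "kre (- a :: 'k::real_or_complex) = - kre a"
  using kre_add[of a "- a"] by simp

lemma kre_diff: "kre (a - b :: 'k::real_or_complex) = kre a - kre b"
  using kre_add[of a "- b"] by simp

lemma kre_sum: "kre (sum f A :: 'k::real_or_complex) = (\<Sum>x\<in>A. kre (f x))"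
  by (induction A rule: infinite_finite_induct) (simp_all add: kre_add)

lemma kre_of_real_mult [simp]: "kre (of_real r * a :: 'k::real_or_complex) = r * kre a"
proof -
  have "(of_real (2 * kre (of_real r * a)) :: 'k) = of_real r * (a + kcnj a)"
    using add_kcnj'[of "of_real r * a"] by (simp add: kcnj_mult algebra_simps)
  also have "\<dots> = of_real (2 * (r * kre a))" by (simp add: add_kcnj')
  finally show ?thesis by (rule of_real_double_cancel)
qed

lemma abs_kre_le_norm: "\<bar>kre (a::'k::real_or_complex)\<bar> \<le> norm a"
proof -
  have "2 * \<bar>kre a\<bar> = norm (a + kcnj a)" by (simp add: add_kcnj' norm_mult)
  also have "\<dots> \<le> norm a + norm (kcnj a)" by (rule norm_triangle_ineq)
  finally show ?thesis by simp
qed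

lemma of_real_kre_self_conj:
  assumes "kcnj a = (a::'k::real_or_complex)"
  shows "of_real (kre a) = a"
  using add_kcnj'[of a] assms by simp

section \<open>Inner products and orthonormal sets\<close>

context fin_dim_hilbert_space
begin

lemma ip_zero_left [simp]: "ip 0 y = 0"
  using ip_scale_left[of 0 0 y] by simp

lemma ip_zero_right [simp]: "ip x 0 = 0"
  using ip_commute[of x 0] by simp

lemma ip_eq_0_commute: "ip x y = 0 \<Longrightarrow> ip y x = 0"
  by (subst ip_commute) simp

lemma ip_add_right: "ip x (y + z) = ip x y + ip x z"
  unfolding ip_commute[of x] ip_add_left kcnj_add by (rule refl)

lemma ip_scale_right: "ip x (smul a y) = kcnj a * ip x y"
  unfolding ip_commute[of x] ip_scale_left kcnj_mult by (rule refl)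

lemma ip_minus_left [simp]: "ip (- x) y = - ip x y"
  using ip_add_left[of x "- x" y] by (simp add: eq_neg_iff_add_eq_0 add.commute)

lemma ip_minus_right [simp]: "ip x (- y) = - ip x y"
  using ip_add_right[of x y "- y"] by (simp add: eq_neg_iff_add_eq_0 add.commute)

lemma ip_diff_left: "ip (x - y) z = ip x z - ip y z"
  using ip_add_left[of x "- y" z] by simp

lemma ip_diff_right: "ip x (y - z) = ip x y - ip x z"
  using ip_add_right[of x y "- z"] by simp

lemma ip_sum_left: "ip (sum f A) y = (\<Sum>x\<in>A. ip (f x) y)"
  by (induction A rule: infinite_finite_induct) (simp_all add: ip_add_left)

lemmas ip_simps = ip_add_left ip_add_right ip_diff_left ip_diff_right
  ip_scale_left ip_scale_right

lemma kre_ip_commute: "kre (ip x y) = kre (ip y x)"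
  by (subst ip_commute) simp

text \<open>By \<open>ip_commute\<close> the scalar \<open>ip x x\<close> is its own conjugate,
  hence real, and its nonnegativity undoes the square root in \<open>nrm\<close>.\<close>

lemma ip_self: "ip x x = of_real ((nrm ip x)\<^sup>2)"
  using of_real_kre_self_conj[OF ip_commute[of x x, symmetric]] ip_self_nonneg[of x]
  by (simp add: nrm_def flip: of_real_power)

lemma kre_ip_self: "kre (ip x x) = (nrm ip x)\<^sup>2"
  unfolding ip_self by (rule kre_of_real)

lemma nrm_nonneg [simp]: "0 \<le> nrm ip x"
  by (simp add: nrm_def ip_self_nonneg)

lemma nrm_eq_0_iff [simp]: "nrm ip x = 0 \<longleftrightarrow> x = 0"
proof
  assume "nrm ip x = 0"
  then have "ip x x = 0" by (simp add: ip_self)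
  then show "x = 0" by (rule ip_self_eq_0)
qed (simp add: nrm_def)

lemma nrm_scale: "nrm ip (smul a x) = norm a * nrm ip x"
proof -
  have "of_real ((nrm ip (smul a x))\<^sup>2) = (a * kcnj a) * ip x x"
    unfolding ip_self[symmetric] by (simp add: ip_scale_left ip_scale_right)
  also have "\<dots> = of_real ((norm a * nrm ip x)\<^sup>2)"
    by (simp add: mult_kcnj' ip_self power_mult_distrib)
  finally have "(nrm ip (smul a x))\<^sup>2 = (norm a * nrm ip x)\<^sup>2"
    by (simp only: of_real_eq_iff)
  then show ?thesis by (simp add: power2_eq_iff_nonneg)
qed

lemma eq_by_ip:
  assumes "\<And>z. ip x z = ip y z"
  shows "x = y"
proof -
  have "ip (x - y) (x - y) = 0" using assms[of "x - y"] by (simp only: ip_diff_left diff_self)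
  then have "x - y = 0" by (rule ip_self_eq_0)
  then show ?thesis by simp
qed

lemma cauchy_schwarz: "(norm (ip x y))\<^sup>2 \<le> (nrm ip x)\<^sup>2 * (nrm ip y)\<^sup>2"
proof (cases "x = 0")
  case False
  define X where "X = (nrm ip x)\<^sup>2"
  have X: "0 < X" using False by (simp add: X_def)
  \<comment> \<open>\<open>w\<close> is \<open>X\<close> times the component of \<open>y\<close>
    orthogonal to \<open>x\<close>, which avoids division. Its squared norm is \<open>X\<close>
    times the difference of the two sides.\<close>
  define w where "w = smul (of_real X) y - smul (ip y x) x"
  have c: "ip x y * ip y x = of_real ((norm (ip x y))\<^sup>2)"
    unfolding ip_commute[of y] by (rule mult_kcnj')
  have "ip x x = of_real X" by (simp only: X_def ip_self)
  then have "ip w w = of_real X * (of_real X * ip y y - ip x y * ip y x)"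
    using ip_commute[of x y] by (simp add: w_def ip_simps algebra_simps)
  also have "\<dots> = of_real (X * (X * (nrm ip y)\<^sup>2 - (norm (ip x y))\<^sup>2))"
    by (simp add: c ip_self)
  finally have "0 \<le> X * (X * (nrm ip y)\<^sup>2 - (norm (ip x y))\<^sup>2)"
    using ip_self_nonneg[of w] by (simp only: kre_of_real)
  then show ?thesis using X by (simp add: zero_le_mult_iff X_def)
qed simp

section \<open>Orthonormal systems and the Gram-Schmidt process\<close>

definition orthonormal :: "'v set \<Rightarrow> bool" where
  "orthonormal E \<longleftrightarrow> (\<forall>x\<in>E. \<forall>y\<in>E. ip x y = (if x = y then 1 else 0))"

text \<open>For finite orthonormal \<open>E\<close> this is the projection onto
  \<open>span E\<close>. The explicit sum supplies the existence that the definite description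
  \<open>orth_proj\<close> requires.\<close>

definition onb_proj :: "'v set \<Rightarrow> 'v \<Rightarrow> 'v" where
  "onb_proj E x = (\<Sum>e\<in>E. smul (ip x e) e)"

lemma onb_proj_in_span: "onb_proj E x \<in> span E"
  unfolding onb_proj_def by (intro span_sum span_scale span_base)

lemma ip_onb_proj:
  assumes "finite E" "orthonormal E" "z \<in> span E"
  shows "ip (x - onb_proj E x) z = 0"
proof -
  have e: "ip (x - onb_proj E x) e = 0" if "e \<in> E" for e
  proof -
    have "ip (onb_proj E x) e = (\<Sum>e'\<in>E. if e' = e then ip x e' else 0)"
      unfolding onb_proj_def ip_sum_left using assms(2) that
      by (intro sum.cong) (auto simp: ip_simps orthonormal_def)
    also have "\<dots> = ip x e" using assms(1) that by simp
    finally show ?thesis by (simp add: ip_simps)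
  qed
  show ?thesis
    using assms(3) by (induction rule: span_induct_alt) (simp_all add: ip_add_right ip_scale_right e)
qed

text \<open>The residual \<open>r\<close> of a new vector is either zero, so that the span does not
  grow, or it can be normalised and adjoined.\<close>

lemma gram_schmidt:
  assumes "finite B"
  shows "\<exists>E. finite E \<and> orthonormal E \<and> span E = span B"
  using assms
proof (induction B)
  case empty
  show ?case by (rule exI[of _ "{}"]) (simp add: orthonormal_def)
next
  case (insert b B)
  then obtain E where E: "finite E" "orthonormal E" "span E = span B" by blast
  define r where "r = b - onb_proj E b"
  have p: "onb_proj E b \<in> span E" by (rule onb_proj_in_span)
  show ?case
  proof (cases "r = 0")
    case True
    then have "b \<in> span B" using p E(3) by (simp add: r_def)
    then have "span (insert b B) = span B" by (rule span_redundant)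
    then show ?thesis using E by blast
  next
    case False
    define a where "a = nrm ip r"
    have a: "a \<noteq> 0" using False by (simp add: a_def)
    define e where "e = smul (of_real (1 / a)) r"
    have re: "r = smul (of_real a) e" using a by (simp add: e_def flip: of_real_mult)
    have "ip r r = of_real (a\<^sup>2)" by (simp only: ip_self a_def)
    then have "ip e e = of_real (1 / a * (1 / a) * a\<^sup>2)"
      by (simp only: e_def ip_scale_left ip_scale_right kcnj_of_real of_real_mult mult.assoc)
    then have ee: "ip e e = 1" using a by (simp add: power2_eq_square)
    have ez: "ip e z = 0" "ip z e = 0" if "z \<in> E" for z
    proof -
      show "ip e z = 0"
        using ip_onb_proj[OF E(1,2) span_base[OF that]] by (simp add: e_def ip_simps r_def)
      then show "ip z e = 0" using ip_commute[of z e] by simp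
    qed
    have "orthonormal (insert e E)"
      unfolding orthonormal_def
    proof (intro ballI)
      fix x y assume xy: "x \<in> insert e E" "y \<in> insert e E"
      \<comment> \<open>Otherwise \<open>ez\<close> would make \<open>e\<close> orthogonal to
        itself, against \<open>ee\<close>.\<close>
      have "e \<notin> E" using ez(1)[of e] ee by auto
      then show "ip x y = (if x = y then 1 else 0)"
        using xy E(2) by (cases "x = e"; cases "y = e") (auto simp: ee ez orthonormal_def)
    qed
    moreover have "span (insert e E) = span (insert b B)"
    proof -
      have 1: "span E \<subseteq> span (insert e E)" "span B \<subseteq> span (insert b B)"
        by (simp_all add: span_mono subset_insertI)
      have "r \<in> span (insert e E)" 
        unfolding re by (intro span_scale span_base) simp
      then have "r + onb_proj E b \<in> span (insert e E)"
        using p 1(1) by (intro span_add) auto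
      then have b: "b \<in> span (insert e E)" by (simp add: r_def)
      have "r \<in> span (insert b B)" unfolding r_def
        using p 1(2) E(3) span_base[of b "insert b B"] by (intro span_diff) auto
      then have "e \<in> span (insert b B)" unfolding e_def by (rule span_scale)
      moreover have "E \<subseteq> span (insert b B)" "B \<subseteq> span (insert e E)"
        using 1 E(3) span_superset[of E] span_superset[of B] by simp_all
      ultimately show ?thesis using b by (simp add: span_eq)
    qed
    moreover have "finite (insert e E)" using E(1) by simp
    ultimately show ?thesis by (intro exI[of _ "insert e E"] conjI)
  qed
qed

lemma subspace_orthonormal_basis:
  assumes "subspace U"
  obtains E where "finite E" "orthonormal E" "span E = U"
proof -
  obtain C where C: "finite C" "span C = UNIV" using finite_basis by blast
  obtain B where B: "B \<subseteq> U" "independent B" "U \<subseteq> span B"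
    by (rule basis_exists[of U])
  \<comment> \<open>An independent set is no larger than the finite spanning set
    \<open>C\<close>.\<close>
  have "finite B" using independent_span_bound[OF C(1) B(2)] C(2) by simp
  from gram_schmidt[OF this] obtain E where E: "finite E" "orthonormal E" "span E = span B"
    by blast
  moreover have "span B = U" 
    using span_minimal[OF B(1) assms] B(3) by (rule subset_antisym)
  ultimately show ?thesis by (intro that) simp_all
qed

section \<open>Orthogonal projections\<close>

text \<open>Two candidates differ by a vector of \<open>U\<close> that is orthogonal to
  \<open>U\<close>, hence to itself. Linearity of the projection also follows from this
  uniqueness.\<close>

lemma orth_proj_eqI:
  assumes "subspace U" "y \<in> U" "\<And>z. z \<in> U \<Longrightarrow> ip (x - y) z = 0"
  shows "orth_proj ip U x = y"
  unfolding orth_proj_def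
proof (rule the_equality)
  fix y' assume y': "y' \<in> U \<and> (\<forall>z\<in>U. ip (x - y') z = 0)"
  then have "y - y' \<in> U" using assms by (simp add: subspace_diff)
  then have "ip (x - y') (y - y') = 0" "ip (x - y) (y - y') = 0" using y' assms by auto
  moreover have "ip (y - y') d = ip (x - y') d - ip (x - y) d" for d
    by (simp add: ip_diff_left)
  ultimately have "ip (y - y') (y - y') = 0" by simp
  then have "y - y' = 0" by (rule ip_self_eq_0)
  then show "y' = y" by simp
qed (use assms in auto)

lemma orth_proj:
  assumes "subspace U"
  shows orth_proj_in: "orth_proj ip U x \<in> U"
    and orth_proj_orth: "z \<in> U \<Longrightarrow> ip (x - orth_proj ip U x) z = 0"
proof -
  obtain E where E: "finite E" "orthonormal E" "span E = U"
    using subspace_orthonormal_basis[OF assms] .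
  have 1: "onb_proj E x \<in> U" using onb_proj_in_span E(3) by blast
  have 2: "ip (x - onb_proj E x) z = 0" if "z \<in> U" for z using ip_onb_proj[OF E(1,2)] that E(3) by blast
  have eq: "orth_proj ip U x = onb_proj E x" by (rule orth_proj_eqI[OF assms 1 2])
  show "orth_proj ip U x \<in> U" unfolding eq by (rule 1)
  show "ip (x - orth_proj ip U x) z = 0" if "z \<in> U" unfolding eq by (rule 2[OF that])
qed

lemma orth_proj_add:
  assumes "subspace U"
  shows "orth_proj ip U (x + y) = orth_proj ip U x + orth_proj ip U y"
proof (rule orth_proj_eqI[OF assms])
  show "orth_proj ip U x + orth_proj ip U y \<in> U"
    by (intro subspace_add assms orth_proj_in)
next
  fix z assume z: "z \<in> U"
  show "ip (x + y - (orth_proj ip U x + orth_proj ip U y)) z = 0"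
    unfolding add_diff_add ip_add_left by (simp only: orth_proj_orth[OF assms z] add_0)
qed

lemma orth_proj_scale:
  assumes "subspace U"
  shows "orth_proj ip U (smul a x) = smul a (orth_proj ip U x)"
proof (rule orth_proj_eqI[OF assms])
  show "smul a (orth_proj ip U x) \<in> U"
    by (intro subspace_scale assms orth_proj_in)
next
  fix z assume z: "z \<in> U"
  show "ip (smul a x - smul a (orth_proj ip U x)) z = 0"
    unfolding scale_right_diff_distrib[symmetric] ip_scale_left orth_proj_orth[OF assms z] by simp
qed

text \<open>Both sides equal the inner product of the two projections.\<close>

lemma ip_orth_proj_self_adjoint:
  assumes "subspace U"
  shows "ip (orth_proj ip U x) y = ip x (orth_proj ip U y)"
proof -
  have "ip (y - orth_proj ip U y) (orth_proj ip U x) = 0"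
    by (rule orth_proj_orth[OF assms orth_proj_in[OF assms]])
  then have "ip (orth_proj ip U x) (y - orth_proj ip U y) = 0"
    by (rule ip_eq_0_commute)
  moreover have "ip (x - orth_proj ip U x) (orth_proj ip U y) = 0"
    by (rule orth_proj_orth[OF assms orth_proj_in[OF assms]])
  ultimately show ?thesis by (simp add: ip_simps)
qed

lemma ip_orth_proj_self:
  assumes "subspace U"
  shows "ip (orth_proj ip U x) x = of_real ((nrm ip (orth_proj ip U x))\<^sup>2)"
  using orth_proj_orth[OF assms orth_proj_in[OF assms], of x x]
    ip_orth_proj_self_adjoint[OF assms, of x x]
  by (simp add: ip_self ip_simps)

section \<open>Traces\<close>

text \<open>Names the very basis that \<open>op_trace\<close> selects, so that traces can be
  computed with it.\<close>

definition onb :: "'v set" where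
  "onb = (SOME E. orthonormal_basis smul ip E)"

lemma onb: "orthonormal_basis smul ip onb"
proof -
  obtain E where "finite E" "orthonormal E" "span E = UNIV"
    using subspace_orthonormal_basis[OF subspace_UNIV] .
  then have "orthonormal_basis smul ip E"
    by (simp add: orthonormal_basis_def orthonormal_def)
  then show ?thesis unfolding onb_def by (rule someI)
qed

lemma finite_onb: "finite onb" and span_onb: "span onb = UNIV"
  and orthonormal_onb: "orthonormal onb"
  using onb by (simp_all add: orthonormal_basis_def orthonormal_def)

lemma op_trace_onb: "op_trace smul ip T = (\<Sum>e\<in>onb. ip (T e) e)"
  by (simp add: op_trace_def onb_def)

lemma onb_expansion: "(\<Sum>e\<in>onb. smul (ip x e) e) = x"
proof -
  have "x = onb_proj onb x"
    by (rule eq_by_ip)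
      (use ip_onb_proj[OF finite_onb orthonormal_onb, of _ x] in \<open>simp add: span_onb ip_simps\<close>)
  then show ?thesis by (simp add: onb_proj_def)
qed

lemma parseval: "(\<Sum>e\<in>onb. ip x e * ip e y) = ip x y"
proof -
  have "ip x y = ip (\<Sum>e\<in>onb. smul (ip x e) e) y" by (simp add: onb_expansion)
  also have "\<dots> = (\<Sum>e\<in>onb. ip x e * ip e y)" by (simp add: ip_sum_left ip_simps)
  finally show ?thesis by simp
qed

text \<open>Inserting the basis expansion between the two operators gives a double sum of products
  of matrix entries. Exchanging the sums exchanges the operators.\<close>

lemma op_trace_commute:
  assumes A: "\<And>x y. ip (A x) y = ip x (A' y)" and B: "\<And>x y. ip (B x) y = ip x (B' y)"
  shows "op_trace smul ip (A \<circ> B) = op_trace smul ip (B \<circ> A)"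
proof -
  have *: "op_trace smul ip (A \<circ> B) = (\<Sum>e\<in>onb. \<Sum>e'\<in>onb. ip (B e) e' * ip (A e') e)"
    if "\<And>x y. ip (A x) y = ip x (A' y)" for A A' B
    by (simp add: op_trace_onb that parseval)
  show ?thesis
    unfolding *[OF A] *[OF B] by (subst sum.swap) (simp add: mult.commute)
qed

section \<open>Positive operators and their square roots\<close>

lemma positive_opD:
  assumes "positive_op smul ip S"
  shows "Vector_Spaces.linear smul smul S" and "ip (S x) y = ip x (S y)"
    and "0 \<le> kre (ip (S x) x)"
  using assms unfolding positive_op_def by blast+

text \<open>If \<open>S u\<close> were nonzero, a small step from \<open>u\<close> in the direction
  \<open>- S u\<close> would make the quadratic form negative: its value there is
  \<open>- 2 * r * p + r * r * q\<close>.\<close>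

lemma positive_op_kernel:
  assumes "positive_op smul ip S" and "kre (ip (S u) u) = 0"
  shows "S u = 0"
proof (rule ccontr)
  assume "S u \<noteq> 0"
  note sa = positive_opD(2)[OF assms(1)] and pos = positive_opD(3)[OF assms(1)]
  interpret S: Vector_Spaces.linear smul smul S by (rule positive_opD(1)[OF assms(1)])
  define p where "p = (nrm ip (S u))\<^sup>2"
  define q where "q = kre (ip (S (S u)) (S u))"
  have p: "0 < p" using \<open>S u \<noteq> 0\<close> by (simp add: p_def)
  have q: "0 \<le> q" using pos by (simp add: q_def)
  \<comment> \<open>With this step size the quadratic term is at most \<open>r * p\<close>, half of
    the linear loss. The summand 1 keeps the denominator positive when \<open>q = 0\<close>.\<close>
  define r where "r = p / (q + 1)"
  define z where "z = u - smul (of_real r) (S u)"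
  have *: "ip (S z) z = ip (S u) u - of_real r * ip (S u) (S u) - of_real r * ip (S u) (S u)
      + of_real (r * r) * ip (S (S u)) (S u)"
    using sa[of "S u" u] by (simp add: z_def S.diff S.scale ip_simps algebra_simps)
  have "kre (ip (S z) z) = - (2 * r * p) + r * r * q"
    unfolding * kre_add kre_diff kre_of_real_mult assms(2) kre_ip_self p_def q_def by simp
  moreover have "r * r * q = r * p * (q / (q + 1))" by (simp add: r_def)
  moreover have "r * p * (q / (q + 1)) \<le> r * p * 1"
    using p q by (intro mult_left_mono) (simp_all add: r_def)
  moreover have "0 < r * p" using p q by (simp add: r_def)
  ultimately show False using pos[of z] by simp
qed

lemma self_adjoint_square_0:
  assumes "\<And>x y. ip (D x) y = ip x (D y)" and "D (D u) = 0"
  shows "D u = 0"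
  using assms(1)[of "D u" u] assms(2) by (auto intro: ip_self_eq_0)

lemma linear_eq_0_on_onb:
  assumes "Vector_Spaces.linear smul smul L" "\<And>e. e \<in> onb \<Longrightarrow> L e = 0"
  shows "L x = 0"
proof -
  interpret L: Vector_Spaces.linear smul smul L by fact
  show ?thesis using L.eq_0_on_span[of onb x] assms(2) span_onb by simp
qed

text \<open>With \<open>D = R - S\<close> one has \<open>R D + D S = R\<^sup>2 - S\<^sup>2 = 0\<close>, so the positive operators \<open>D R D\<close>
  and \<open>D S D\<close> have total trace \<open>tr (D (R D + D S)) = 0\<close>; this replaces the spectral theorem.\<close>

lemma positive_sqrt_unique:
  assumes R: "positive_op smul ip R" and S: "positive_op smul ip S" and RS: "R \<circ> R = S \<circ> S"
  shows "R = S"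
proof -
  note Rsa = positive_opD(2)[OF R] and Ssa = positive_opD(2)[OF S]
    and Rpos = positive_opD(3)[OF R] and Spos = positive_opD(3)[OF S]
  interpret R: Vector_Spaces.linear smul smul R by (rule positive_opD(1)[OF R])
  interpret S: Vector_Spaces.linear smul smul S by (rule positive_opD(1)[OF S])
  define D where "D x = R x - S x" for x
  have Dsa: "ip (D x) y = ip x (D y)" for x y by (simp add: D_def ip_simps Rsa Ssa)
  have lin: "Vector_Spaces.linear smul smul (\<lambda>x. R (D x))" 
    "Vector_Spaces.linear smul smul (\<lambda>x. S (D x))"
    by unfold_locales
      (simp_all add: D_def R.add S.add R.diff S.diff R.scale S.scale algebra_simps
        scale_right_diff_distrib)
  have RR: "R (R x) = S (S x)" for x using RS by (metis comp_apply)
  have "R (D x) + D (S x) = 0" for x by (simp add: D_def R.diff RR)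
  then have 1: "D (S x) = - R (D x)" for x by (simp add: eq_neg_iff_add_eq_0 add.commute)
  \<comment> \<open>Moving the outer \<open>D\<close> across the inner product, the left trace
    becomes the negated sum of \<open>ip (R (D e)) (D e)\<close> by \<open>1\<close>, and the right
    one the sum of \<open>ip (S (D e)) (D e)\<close>.\<close>
  have "op_trace smul ip (D \<circ> (D \<circ> S)) = op_trace smul ip ((D \<circ> S) \<circ> D)"
    by (rule op_trace_commute[where A' = D and B' = "S \<circ> D"]) (simp_all add: Dsa Ssa)
  moreover have "ip (D (D (S e))) e = - ip (R (D e)) (D e)" for e
    using Dsa[of "D (S e)" e] by (simp add: 1)
  ultimately have "- (\<Sum>e\<in>onb. ip (R (D e)) (D e)) = (\<Sum>e\<in>onb. ip (S (D e)) (D e))"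
    by (simp add: op_trace_onb Dsa[of "S _"] sum_negf)
  then have "(\<Sum>e\<in>onb. ip (S (D e)) (D e) + ip (R (D e)) (D e)) = 0"
    by (simp only: sum.distrib neg_eq_iff_add_eq_0 add.commute)
  then have "kre (\<Sum>e\<in>onb. ip (S (D e)) (D e) + ip (R (D e)) (D e)) = 0" by simp
  then have "(\<Sum>e\<in>onb. kre (ip (S (D e)) (D e)) + kre (ip (R (D e)) (D e))) = 0"
    by (simp add: kre_sum kre_add)
  then have "kre (ip (S (D e)) (D e)) + kre (ip (R (D e)) (D e)) = 0" if "e \<in> onb" for e
    using that sum_nonneg_eq_0_iff[OF finite_onb] Rpos Spos by (metis (no_types, lifting) add_nonneg_nonneg)
  then have "S (D e) = 0 \<and> R (D e) = 0" if "e \<in> onb" for e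
    using that positive_op_kernel[OF R] positive_op_kernel[OF S] Rpos[of "D e"] Spos[of "D e"]
    by (metis add_nonneg_eq_0_iff)
  then have "R (D x) = 0" "S (D x) = 0" for x
    using linear_eq_0_on_onb[OF lin(1)] linear_eq_0_on_onb[OF lin(2)] by blast+
  then have "D (D x) = 0" for x by (simp add: D_def[of "D x"])
  then have "D x = 0" for x using self_adjoint_square_0[of D] Dsa by blast
  then show ?thesis by (auto simp: D_def)
qed

lemma hadjoint_self_adjoint:
  assumes "\<And>x y. ip (T x) y = ip x (T y)"
  shows "hadjoint ip T = T"
  unfolding hadjoint_def
proof (rule the_equality)
  fix S assume "\<forall>x y. ip (T x) y = ip x (S y)"
  then have "ip x (T y) = ip x (S y)" for x y using assms by simp
  then have "ip (T y) x = ip (S y) x" for x y by (metis ip_commute)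
  then show "S = T" by (auto intro!: ext eq_by_ip)
qed (use assms in auto)

text \<open>A self-adjoint \<open>T\<close> is its own adjoint, so uniqueness of positive square
  roots identifies the absolute value once some root of the square of \<open>T\<close> is
  exhibited.\<close>

lemma abs_op_eqI:
  assumes "\<And>x y. ip (T x) y = ip x (T y)" "positive_op smul ip R" "R \<circ> R = T \<circ> T"
  shows "abs_op smul ip T = R"
  unfolding abs_op_def hadjoint_self_adjoint[of T, OF assms(1)]
  using assms positive_sqrt_unique by (intro the_equality) auto

text \<open>The diagonal entries have nonnegative real parts. If these sum to zero, each vanishes,
  and \<open>positive_op_kernel\<close> kills every basis vector.\<close>

lemma positive_op_trace:
  assumes "positive_op smul ip R"
  shows "0 \<le> kre (op_trace smul ip R)"
    and "kre (op_trace smul ip R) = 0 \<longleftrightarrow> (\<forall>x. R x = 0)"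
proof -
  note pos = positive_opD(3)[OF assms]
  show "0 \<le> kre (op_trace smul ip R)"
    by (simp add: op_trace_onb kre_sum sum_nonneg pos)
  have "\<forall>x. R x = 0" if "kre (op_trace smul ip R) = 0"
  proof -
    have "\<forall>e\<in>onb. kre (ip (R e) e) = 0"
      using that sum_nonneg_eq_0_iff[OF finite_onb, of "\<lambda>e. kre (ip (R e) e)"] pos
      by (simp add: op_trace_onb kre_sum)
    then have "R e = 0" if "e \<in> onb" for e using positive_op_kernel[OF assms] that by blast
    then show ?thesis using linear_eq_0_on_onb[OF positive_opD(1)[OF assms]] by blast
  qed
  then show "kre (op_trace smul ip R) = 0 \<longleftrightarrow> (\<forall>x. R x = 0)"
    by (auto simp: op_trace_onb)
qed

section \<open>The operator \<open>x \<otimes> x - y \<otimes> y\<close>\<close>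

definition rank_one_diff :: "'v \<Rightarrow> 'v \<Rightarrow> 'v \<Rightarrow> 'v" where
  "rank_one_diff x y u = smul (ip u x) x - smul (ip u y) y"

lemma half_double: "smul (1/2) (z + z) = z"
  by (simp only: scale_right_distrib scale_left_distrib[symmetric]) simp

text \<open>The mixed terms cancel and the pure terms double, which absorbs the factor 1/2.\<close>

lemma bracket_add_diff: "bracket smul ip (x + y) (x - y) = rank_one_diff x y"
proof
  fix u
  have "smul (ip u (x - y)) (x + y) + smul (ip u (x + y)) (x - y)
      = rank_one_diff x y u + rank_one_diff x y u"
    by (simp add: rank_one_diff_def ip_add_right ip_diff_right scale_left_distrib
        scale_left_diff_distrib scale_right_distrib scale_right_diff_distrib)
  then show "bracket smul ip (x + y) (x - y) u = rank_one_diff x y u"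
    unfolding bracket_def outer_def by (simp only: half_double)
qed

lemma add_diff_decomp:
  fixes f g :: 'v
  obtains x y where "f = x + y" "g = x - y"
proof
  let ?x = "smul (1/2) (f + g)" and ?y = "smul (1/2) (f - g)"
  have "?x + ?y = smul (1/2) (f + f)" "?x - ?y = smul (1/2) (g + g)"
    by (simp_all flip: scale_right_distrib scale_right_diff_distrib)
  then show "f = ?x + ?y" "g = ?x - ?y" by (simp_all only: half_double)
qed

lemma linear_rank_one_diff: "Vector_Spaces.linear smul smul (rank_one_diff x y)"
  by unfold_locales
    (simp_all add: rank_one_diff_def ip_add_left ip_scale_left scale_left_distrib
      scale_right_distrib scale_right_diff_distrib)

lemma rank_one_diff_self_adjoint:
  "ip (rank_one_diff x y u) z = ip u (rank_one_diff x y z)"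
proof -
  have "ip u (rank_one_diff x y z) = kcnj (ip z x) * ip u x - kcnj (ip z y) * ip u y"
    by (simp add: rank_one_diff_def ip_diff_right ip_scale_right)
  then show ?thesis
    by (simp add: rank_one_diff_def ip_diff_left ip_scale_left mult.commute flip: ip_commute)
qed

definition tr_param :: "'v \<Rightarrow> 'v \<Rightarrow> real" where
  "tr_param x y = (nrm ip x)\<^sup>2 - (nrm ip y)\<^sup>2"

definition gram_det :: "'v \<Rightarrow> 'v \<Rightarrow> real" where
  "gram_det x y = (nrm ip x)\<^sup>2 * (nrm ip y)\<^sup>2 - (norm (ip x y))\<^sup>2"

text \<open>This sign makes the discriminant \<open>t\<^sup>2 + 4 * d\<close> in the construction of
  the absolute value nonnegative.\<close>

lemma gram_det_nonneg: "0 \<le> gram_det x y"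
  using cauchy_schwarz[of x y] by (simp add: gram_det_def)

text \<open>Cayley-Hamilton: on the span of \<open>x\<close> and \<open>y\<close> the operator has trace \<open>tr_param x y\<close> and
  determinant \<open>- gram_det x y\<close>.\<close>

lemma rank_one_diff_cubic:
  "rank_one_diff x y (rank_one_diff x y (rank_one_diff x y u)) =
    smul (of_real (tr_param x y)) (rank_one_diff x y (rank_one_diff x y u))
    + smul (of_real (gram_det x y)) (rank_one_diff x y u)"
proof -
  define T where "T = rank_one_diff x y"
  interpret T: Vector_Spaces.linear smul smul T
    unfolding T_def by (rule linear_rank_one_diff)
  define t where "t = (of_real (tr_param x y) :: 'k)"
  define d where "d = (of_real (gram_det x y) :: 'k)"
  define X where "X = ip x x"
  define Y where "Y = ip y y"
  define a where "a = ip x y"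
  define b where "b = ip y x"
  have t: "t = X - Y" by (simp add: t_def tr_param_def X_def Y_def ip_self)
  have "a * b = of_real ((norm a)\<^sup>2)"
    unfolding a_def b_def ip_commute[of y x] by (rule mult_kcnj')
  then have d: "d = X * Y - a * b"
    by (simp add: d_def gram_det_def X_def Y_def ip_self a_def)
  have Tx: "T x = smul X x - smul a y" and Ty: "T y = smul b x - smul Y y"
    by (simp_all add: T_def rank_one_diff_def X_def Y_def a_def b_def)
  \<comment> \<open>The quadratic Cayley-Hamilton identity on the generators \<open>x\<close> and
    \<open>y\<close> of the range. As \<open>T u\<close> lies in their span, one further application
    of \<open>T\<close> gives the cubic identity for every \<open>u\<close>.\<close>
  have x: "T (T x) = smul t (T x) + smul d x"
    unfolding Tx T.diff T.scale Ty t d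
    by (simp add: algebra_simps scale_left_diff_distrib scale_right_diff_distrib)
  have y: "T (T y) = smul t (T y) + smul d y"
    unfolding Ty T.diff T.scale Tx t d
    by (simp add: algebra_simps scale_left_diff_distrib scale_right_diff_distrib)
  have u: "T u = smul (ip u x) x - smul (ip u y) y"
    by (simp add: T_def rank_one_diff_def)
  have "T (T (T u)) = smul t (T (T u)) + smul d (T u)"
    unfolding u T.diff T.scale x y
    by (simp add: scale_right_diff_distrib scale_right_distrib mult.commute)
  then show ?thesis by (simp only: T_def t_def d_def)
qed

text \<open>This is positivity of \<open>2 T\<^sup>2 - t T\<close>, the numerator of the absolute
  value. After expansion the right side minus the left is \<open>((norm a)\<^sup>2 + (norm
  b)\<^sup>2) * ((nrm ip x)\<^sup>2 + (nrm ip y)\<^sup>2) - 4 * kre k\<close>, bounded by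
  Cauchy-Schwarz and two uses of the arithmetic-geometric mean inequality.\<close>

lemma rank_one_diff_pos:
  "tr_param x y * kre (ip (rank_one_diff x y u) u) \<le> 2 * (nrm ip (rank_one_diff x y u))\<^sup>2"
proof -
  define a where "a = ip u x"
  define b where "b = ip u y"
  define k where "k = a * kcnj b * ip x y"
  have xu: "ip x u = kcnj a" "ip y u = kcnj b" by (simp_all add: a_def b_def flip: ip_commute)
  have Tu: "rank_one_diff x y u = smul a x - smul b y"
    by (simp add: rank_one_diff_def a_def b_def)
  have "ip (rank_one_diff x y u) u = of_real ((norm a)\<^sup>2 - (norm b)\<^sup>2)"
    by (simp only: Tu ip_diff_left ip_scale_left xu mult_kcnj' of_real_diff)
  then have 1: "kre (ip (rank_one_diff x y u) u) = (norm a)\<^sup>2 - (norm b)\<^sup>2"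
    by (simp only: kre_of_real)
  have "ip (rank_one_diff x y u) (rank_one_diff x y u)
      = a * kcnj a * ip x x + b * kcnj b * ip y y - (k + kcnj k)"
    using ip_commute[of y x]
    by (simp add: Tu k_def ip_diff_left ip_diff_right ip_scale_left ip_scale_right kcnj_mult
        kcnj_kcnj algebra_simps)
  also have "\<dots> = of_real ((norm a)\<^sup>2 * (nrm ip x)\<^sup>2 + (norm b)\<^sup>2 * (nrm ip y)\<^sup>2 - 2 * kre k)"
    by (simp add: mult_kcnj' add_kcnj' ip_self)
  finally have 2: "(nrm ip (rank_one_diff x y u))\<^sup>2
      = (norm a)\<^sup>2 * (nrm ip x)\<^sup>2 + (norm b)\<^sup>2 * (nrm ip y)\<^sup>2 - 2 * kre k"
    unfolding ip_self of_real_eq_iff .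
  have "norm (ip x y) \<le> nrm ip x * nrm ip y"
    by (rule power2_le_imp_le) (simp_all add: power_mult_distrib cauchy_schwarz)
  then have "norm a * norm b * norm (ip x y) \<le> norm a * norm b * (nrm ip x * nrm ip y)"
    by (intro mult_left_mono) simp_all
  moreover have "kre k \<le> norm a * norm b * norm (ip x y)"
    using abs_kre_le_norm[of k] by (simp add: k_def norm_mult)
  ultimately have k: "4 * kre k \<le> (2 * norm a * norm b) * (2 * nrm ip x * nrm ip y)" by simp
  also have "\<dots> \<le> ((norm a)\<^sup>2 + (norm b)\<^sup>2) * ((nrm ip x)\<^sup>2 + (nrm ip y)\<^sup>2)"
    by (intro mult_mono sum_squares_bound) simp_all
  finally show ?thesis unfolding 1 2 tr_param_def by (simp add: algebra_simps)
qed

text \<open>Let \<open>T\<close> have eigenvalues \<open>\<lambda> \<ge> 0 \<ge> \<mu>\<close>, and possibly \<open>0\<close>. The polynomial without constant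
  term that interpolates the absolute value at \<open>\<lambda>\<close> and \<open>\<mu>\<close> gives
  \<open>\<bar>T\<bar> = (2 T\<^sup>2 - t T) / s\<close> with \<open>t = \<lambda> + \<mu>\<close> and \<open>s = \<lambda> - \<mu>\<close>.\<close>

lemma rank_one_diff_abs:
  obtains R where "positive_op smul ip R"
    "R \<circ> R = rank_one_diff x y \<circ> rank_one_diff x y"
proof -
  define T where "T = rank_one_diff x y"
  have lin: "Vector_Spaces.linear smul smul T"
    unfolding T_def by (rule linear_rank_one_diff)
  interpret T: Vector_Spaces.linear smul smul T by (rule lin)
  have sa: "ip (T u) z = ip u (T z)" for u z
    unfolding T_def by (rule rank_one_diff_self_adjoint)
  define t where "t = tr_param x y"
  define d where "d = gram_det x y"
  have cubic: "T (T (T u)) = smul (of_real t) (T (T u)) + smul (of_real d) (T u)" for u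
    unfolding T_def t_def d_def by (rule rank_one_diff_cubic)
  have d: "0 \<le> d" unfolding d_def by (rule gram_det_nonneg)
  show ?thesis
  proof (cases "t\<^sup>2 + 4 * d = 0")
    \<comment> \<open>Here the denominator \<open>s\<close> would be zero. The cubic identity makes
      \<open>T\<close> nilpotent, and a self-adjoint nilpotent operator is zero, so \<open>T\<close>
      is its own absolute value.\<close>
    case True
    then have "t = 0" "d = 0" using d by (simp_all add: add_nonneg_eq_0_iff)
    then have "T (T (T u)) = 0" for u using cubic[of u] by simp
    then have "T (T u) = 0" for u by (rule self_adjoint_square_0[of T, OF sa])
    then have T0: "T u = 0" for u by (rule self_adjoint_square_0[of T, OF sa])
    have "positive_op smul ip T" unfolding positive_op_def using lin by (simp add: T0)
    then show ?thesis unfolding T_def by (rule that) (rule refl)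
  next
    case False
    define s where "s = sqrt (t\<^sup>2 + 4 * d)"
    have s: "0 < s" using False d by (simp add: s_def add_nonneg_pos less_le)
    define r where "r = 1 / s"
    have r: "0 < r" using s by (simp add: r_def)
    have r2: "r * r * (4 * d + t\<^sup>2) = 1"
      using s d by (simp add: r_def s_def add.commute)
    define R where
      "R u = smul (of_real r) (smul (of_real 2) (T (T u)) - smul (of_real t) (T u))" for u
    have "R (R u) = T (T u)" for u
    proof -
      \<comment> \<open>The square is \<open>r\<^sup>2 (4 T\<^sup>4 - 4 t T\<^sup>3 + t\<^sup>2
        T\<^sup>2)\<close>. Replacing the fourth power by the cubic identity cancels the third
        powers, and \<open>r2\<close> normalises what remains.\<close>
      have "R (R u) = smul (of_real (r * r)) (smul (of_real 4) (T (T (T (T u))))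
          - (smul (of_real (2 * t)) (T (T (T u))) + smul (of_real (2 * t)) (T (T (T u))))
          + smul (of_real (t * t)) (T (T u)))"
        unfolding R_def T.diff T.scale
        by (simp add: scale_right_diff_distrib scale_right_distrib mult_ac)
      also have "smul (of_real (2 * t)) (T (T (T u))) + smul (of_real (2 * t)) (T (T (T u)))
          = smul (of_real (4 * t)) (T (T (T u)))"
        by (simp flip: scale_left_distrib)
      also have "smul (of_real (r * r)) (smul (of_real 4) (T (T (T (T u))))
          - smul (of_real (4 * t)) (T (T (T u))) + smul (of_real (t * t)) (T (T u)))
          = smul (of_real (r * r * (4 * d + t\<^sup>2))) (T (T u))"
        unfolding cubic[of "T u"]
        by (simp add: scale_right_diff_distrib scale_right_distrib mult_ac
            scale_left_distrib power2_eq_square distrib_left)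
      finally show ?thesis unfolding r2 by simp
    qed
    moreover have "positive_op smul ip R"
      unfolding positive_op_def
    proof (intro conjI allI)
      show "Vector_Spaces.linear smul smul R"
        by unfold_locales
          (simp_all add: R_def T.add T.scale scale_right_distrib scale_right_diff_distrib
            mult.left_commute mult.commute)
    next
      fix u z show "ip (R u) z = ip u (R z)"
        unfolding R_def ip_scale_left ip_scale_right ip_diff_left ip_diff_right sa kcnj_of_real ..
    next
      fix u
      have "ip (R u) u
          = of_real r * (of_real 2 * ip (T (T u)) u - of_real t * ip (T u) u)"
        by (simp add: R_def ip_simps)
      then have "kre (ip (R u) u) = r * (2 * (nrm ip (T u))\<^sup>2 - t * kre (ip (T u) u))"
        unfolding sa[of "T u" u] by (simp only: kre_of_real_mult kre_diff kre_ip_self)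
      then show "0 \<le> kre (ip (R u) u)"
        using r rank_one_diff_pos[of x y u] by (simp add: T_def t_def)
    qed
    ultimately show ?thesis by (intro that[of R]) (simp_all add: T_def fun_eq_iff)
  qed
qed

text \<open>The trace of the absolute value \<open>R\<close> vanishes only for \<open>R = 0\<close>.
  Since \<open>R\<close> and \<open>T\<close> are self-adjoint with equal squares, one is zero
  exactly when the other is.\<close>

lemma trace_norm_rank_one_diff:
  shows trace_norm_rank_one_diff_nonneg: "0 \<le> trace_norm smul ip (rank_one_diff x y)"
    and trace_norm_rank_one_diff_eq_0_iff:
      "trace_norm smul ip (rank_one_diff x y) = 0 \<longleftrightarrow> (\<forall>u. rank_one_diff x y u = 0)"
proof -
  define T where "T = rank_one_diff x y"
  have sa: "ip (T u) z = ip u (T z)" for u z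
    unfolding T_def by (rule rank_one_diff_self_adjoint)
  obtain R where R: "positive_op smul ip R" and RT: "R \<circ> R = T \<circ> T"
    unfolding T_def by (rule rank_one_diff_abs)
  have eq: "trace_norm smul ip T = kre (op_trace smul ip R)"
    unfolding trace_norm_def abs_op_eqI[of T, OF sa R RT] ..
  have RT': "R (R u) = T (T u)" for u using fun_cong[OF RT, of u] by simp
  have "(\<forall>u. R u = 0) \<longleftrightarrow> (\<forall>u. T u = 0)"
  proof
    assume "\<forall>u. R u = 0"
    then have "T (T u) = 0" for u using RT'[of u] by simp
    then have "T u = 0" for u by (rule self_adjoint_square_0[of T, OF sa])
    then show "\<forall>u. T u = 0" ..
  next
    assume "\<forall>u. T u = 0"
    then have "R (R u) = 0" for u using RT'[of u] by simp
    then have "R u = 0" for u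
      by (rule self_adjoint_square_0[of R, OF positive_opD(2)[OF R]])
    then show "\<forall>u. R u = 0" ..
  qed
  then show "0 \<le> trace_norm smul ip (rank_one_diff x y)"
    "trace_norm smul ip (rank_one_diff x y) = 0 \<longleftrightarrow> (\<forall>u. rank_one_diff x y u = 0)"
    using positive_op_trace[OF R] by (simp_all add: eq flip: T_def)
qed

lemma rank_one_diff_eq_0_iff:
  "(\<forall>u. rank_one_diff x y u = 0) \<longleftrightarrow> (x, y) \<in> phase_rel smul"
proof
  assume "\<forall>u. rank_one_diff x y u = 0"
  then have eq: "smul (ip u x) x = smul (ip u y) y" for u by (simp add: rank_one_diff_def)
  show "(x, y) \<in> phase_rel smul"
  proof (cases "x = 0")
    case True
    then have "smul (ip y y) y = 0" using eq[of y] by simp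
    then have "y = 0" using ip_self_eq_0[of y] by auto
    then show ?thesis using True by (auto simp: phase_rel_def intro: exI[of _ 1])
  next
    case False
    then have X: "ip x x \<noteq> 0" using ip_self_eq_0 by blast
    then have "ip x y \<noteq> 0" using eq[of x] False by auto
    \<comment> \<open>The equation at \<open>u = x\<close> reads
      \<open>smul (ip x x) x = smul (ip x y) y\<close>, which dictates this scalar. Inserting
      \<open>y = smul h x\<close> into it again yields \<open>norm h = 1\<close>.\<close>
    define h where "h = ip x x / ip x y"
    have "smul (ip x y) (smul h x) = smul (ip x x) x"
      using \<open>ip x y \<noteq> 0\<close> by (simp add: h_def)
    then have "smul (ip x y) y = smul (ip x y) (smul h x)" by (simp only: eq[of x])
    then have y: "y = smul h x" by (rule scale_left_imp_eq[OF \<open>ip x y \<noteq> 0\<close>])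
    have "smul (ip x x) x = smul (h * kcnj h * ip x x) x"
      using eq[of x] by (simp add: y ip_scale_right mult_ac)
    then have "h * kcnj h = 1" using False X by simp
    then have "(of_real ((norm h)\<^sup>2) :: 'k) = of_real 1" by (simp only: mult_kcnj' of_real_1)
    then have "norm h = 1" unfolding of_real_eq_iff
      by (simp add: abs_square_eq_1)
    then show ?thesis using y by (auto simp: phase_rel_def)
  qed
next
  assume "(x, y) \<in> phase_rel smul"
  then obtain h where h: "norm h = 1" and y: "y = smul h x" by (auto simp: phase_rel_def)
  have "h * kcnj h = 1" by (simp add: mult_kcnj' h)
  moreover have "smul (ip u y) y = smul (h * kcnj h * ip u x) x" for u
    by (simp add: y ip_scale_right mult_ac)
  ultimately have "smul (ip u y) y = smul (ip u x) x" for u by simp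
  then show "\<forall>u. rank_one_diff x y u = 0" by (simp add: rank_one_diff_def)
qed

section \<open>Phase retrieval\<close>

text \<open>By self-adjointness of the projection the two summands are conjugate.\<close>

lemma ip_orth_proj_symmetrized:
  assumes "subspace U"
  shows "ip (orth_proj ip U g) f + ip (orth_proj ip U f) g
    = of_real (2 * kre (ip (orth_proj ip U f) g))"
proof -
  have "ip (orth_proj ip U g) f = kcnj (ip (orth_proj ip U f) g)"
    unfolding ip_orth_proj_self_adjoint[OF assms, of g f] by (rule ip_commute)
  then show ?thesis using add_kcnj'[of "ip (orth_proj ip U f) g"] by (simp add: add.commute)
qed

text \<open>Parseval evaluates the trace of each projected rank-one summand as an inner
  product.\<close>

lemma op_trace_orth_proj_bracket:
  assumes "subspace U"
  shows "op_trace smul ip (orth_proj ip U \<circ> bracket smul ip f g)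
    = of_real (kre (ip (orth_proj ip U f) g))"
proof -
  let ?P = "orth_proj ip U"
  have "ip ((?P \<circ> bracket smul ip f g) e) e
      = 1/2 * (ip (?P f) e * ip e g + ip (?P g) e * ip e f)" for e
    by (simp add: bracket_def outer_def orth_proj_add[OF assms] orth_proj_scale[OF assms]
        ip_add_left ip_scale_left mult.commute)
  then have "op_trace smul ip (?P \<circ> bracket smul ip f g)
      = 1/2 * ((\<Sum>e\<in>onb. ip (?P f) e * ip e g) + (\<Sum>e\<in>onb. ip (?P g) e * ip e f))"
    unfolding op_trace_onb by (simp only: sum.distrib flip: sum_distrib_left)
  also have "\<dots> = 1/2 * (ip (?P g) f + ip (?P f) g)" by (simp add: parseval add.commute)
  finally show ?thesis by (simp add: ip_orth_proj_symmetrized[OF assms])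
qed

text \<open>The mixed terms are conjugate with opposite signs, so their real parts cancel.\<close>

lemma kre_ip_orth_proj_add_diff:
  assumes "subspace U"
  shows "kre (ip (orth_proj ip U (x + y)) (x - y))
    = (nrm ip (orth_proj ip U x))\<^sup>2 - (nrm ip (orth_proj ip U y))\<^sup>2"
proof -
  let ?P = "orth_proj ip U"
  have "kre (ip (?P y) x) = kre (ip (?P x) y)"
    unfolding ip_orth_proj_self_adjoint[OF assms, of y x] by (rule kre_ip_commute)
  then show ?thesis
    unfolding orth_proj_add[OF assms] ip_add_left ip_diff_right ip_orth_proj_self[OF assms]
    by (simp only: kre_add kre_diff kre_of_real)
qed

section \<open>Phase classes and injectivity of the measurement map\<close>

lemma equiv_phase_rel: "equiv UNIV (phase_rel smul)"
proof (rule equivI)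
  show "refl (phase_rel smul)"
    by (rule refl_onI) (auto simp: phase_rel_def intro: exI[of _ 1])
  show "sym (phase_rel smul)"
  proof (rule symI)
    fix x y assume "(x, y) \<in> phase_rel smul"
    then obtain h where h: "norm h = 1" "y = smul h x" by (auto simp: phase_rel_def)
    moreover have "x = smul (inverse h) y" using h by (cases "h = 0") simp_all
    moreover have "norm (inverse h) = 1" by (simp add: norm_inverse h)
    ultimately show "(y, x) \<in> phase_rel smul" unfolding phase_rel_def by blast
  qed
  show "trans (phase_rel smul)"
  proof (rule transI)
    fix x y z assume "(x, y) \<in> phase_rel smul" "(y, z) \<in> phase_rel smul"
    then obtain h k where "norm h = 1" "y = smul h x" "norm k = 1" "z = smul k y"
      by (auto simp: phase_rel_def)
    then have "z = smul (k * h) x" "norm (k * h) = 1" by (simp_all add: norm_mult)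
    then show "(x, z) \<in> phase_rel smul" unfolding phase_rel_def by blast
  qed
qed simp

text \<open>Projections are homogeneous, so the measurements are constant on phase classes and
  injectivity can be tested on representatives.\<close>

lemma inj_on_weave_gamma_iff:
  assumes V: "\<And>i. i \<in> {1..m} \<Longrightarrow> subspace (V i)" and W: "\<And>i. i \<in> {1..m} \<Longrightarrow> subspace (W i)"
  shows "inj_on (weave_gamma ip m V v W w \<sigma>) (UNIV // phase_rel smul) \<longleftrightarrow>
    (\<forall>x y. weave_meas ip m V v W w \<sigma> x = weave_meas ip m V v W w \<sigma> y \<longrightarrow>
      (x, y) \<in> phase_rel smul)"
proof -
  let ?M = "weave_meas ip m V v W w \<sigma>" and ?r = "phase_rel smul"
  have M: "?M y = ?M x" if xy: "(x, y) \<in> ?r" for x y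
  proof -
    from xy obtain h where h: "norm h = 1" "y = smul h x" by (auto simp: phase_rel_def)
    show ?thesis
      unfolding weave_meas_def h(2)
      by (rule restrict_ext) (simp add: orth_proj_scale V W nrm_scale h(1))
  qed
  have "?M ` (?r `` {x}) = {?M x}" for x
  proof (intro equalityI subsetI)
    fix c assume "c \<in> ?M ` (?r `` {x})"
    then show "c \<in> {?M x}" using M by blast
  next
    fix c assume "c \<in> {?M x}"
    moreover have "x \<in> ?r `` {x}" by (rule equiv_class_self[OF equiv_phase_rel UNIV_I])
    ultimately show "c \<in> ?M ` (?r `` {x})" by blast
  qed
  then have g: "weave_gamma ip m V v W w \<sigma> (?r `` {x}) = ?M x" for x
    by (simp add: weave_gamma_def)
  have Q: "UNIV // ?r = (\<lambda>x. ?r `` {x}) ` UNIV" by (auto simp: quotient_def)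
  show ?thesis
    unfolding Q inj_on_def by (simp add: g eq_equiv_class_iff[OF equiv_phase_rel])
qed

lemma closed_subspaceD: "closed_subspace smul ip U \<Longrightarrow> subspace U"
  by (simp add: closed_subspace_def)

text \<open>Matches a coordinate of the measurement map with a summand of (2). The weight may be
  zero or negative: both sides say that \<open>w = 0\<close> or \<open>a = b\<close>.\<close>

lemma weighted_norms_eq_iff:
  fixes w a b :: real
  assumes "0 \<le> a" "0 \<le> b"
  shows "w * a = w * b \<longleftrightarrow> (w\<^sup>2 * (a\<^sup>2 - b\<^sup>2))\<^sup>2 = 0"
  using assms by (auto simp: power2_eq_iff_nonneg)

end

theorem theorem3p6:
  fixes smul :: "'k::real_or_complex \<Rightarrow> 'v::ab_group_add \<Rightarrow> 'v"
    and ip :: "'v \<Rightarrow> 'v \<Rightarrow> 'k"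
    and n m :: nat
    and V W :: "nat \<Rightarrow> 'v set"
    and v w :: "nat \<Rightarrow> real"
  assumes "fin_dim_hilbert_space smul ip n"
    and "weaving_fusion_frames smul ip m V v W w"
  shows "phase_retrievable_weaving smul ip m V v W w \<longleftrightarrow>
    (\<forall>f g. \<forall>\<sigma>\<subseteq>{1..m}. \<exists>\<alpha>>0.
       1/4 * ((\<Sum>i\<in>\<sigma>. (norm (of_real ((v i)\<^sup>2) * ip (orth_proj ip (V i) g) f
                              + of_real ((v i)\<^sup>2) * ip (orth_proj ip (V i) f) g))\<^sup>2)
            + (\<Sum>i\<in>{1..m} - \<sigma>. (norm (of_real ((w i)\<^sup>2) * ip (orth_proj ip (W i) g) f
                              + of_real ((w i)\<^sup>2) * ip (orth_proj ip (W i) f) g))\<^sup>2))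
       = (\<Sum>i\<in>\<sigma>. (norm (of_real ((v i)\<^sup>2) * op_trace smul ip (orth_proj ip (V i) \<circ> bracket smul ip f g)))\<^sup>2)
         + (\<Sum>i\<in>{1..m} - \<sigma>. (norm (of_real ((w i)\<^sup>2) * op_trace smul ip (orth_proj ip (W i) \<circ> bracket smul ip f g)))\<^sup>2)
       \<and>
       (\<Sum>i\<in>\<sigma>. (norm (of_real ((v i)\<^sup>2) * op_trace smul ip (orth_proj ip (V i) \<circ> bracket smul ip f g)))\<^sup>2)
         + (\<Sum>i\<in>{1..m} - \<sigma>. (norm (of_real ((w i)\<^sup>2) * op_trace smul ip (orth_proj ip (W i) \<circ> bracket smul ip f g)))\<^sup>2)
       \<ge> \<alpha> * trace_norm smul ip (bracket smul ip f g))"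
    (is "_ \<longleftrightarrow> (\<forall>f g. \<forall>\<sigma>\<subseteq>{1..m}. \<exists>\<alpha>>0. ?L f g \<sigma> = ?Q f g \<sigma> \<and> ?Q f g \<sigma> \<ge> \<alpha> * ?N f g)")
proof -
  interpret fin_dim_hilbert_space smul ip n by (rule assms(1))
  note weaving = assms(2)
  have V: "subspace (V i)" and W: "subspace (W i)" if "i \<in> {1..m}" for i
    using weaving that by (auto simp: weaving_fusion_frames_def fusion_frame_def closed_subspaceD)
  \<comment> \<open>Both kinds of summand reduce to the same real number. The factor 4 in
    \<open>sym_term\<close> cancels the 1/4 of the claim.\<close>
  have tr_term: "(norm (of_real c * op_trace smul ip (orth_proj ip U \<circ> bracket smul ip f g)))\<^sup>2
      = (c * kre (ip (orth_proj ip U f) g))\<^sup>2"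
    and sym_term: "(norm (of_real c * ip (orth_proj ip U g) f
      + of_real c * ip (orth_proj ip U f) g))\<^sup>2 = 4 * (c * kre (ip (orth_proj ip U f) g))\<^sup>2"
    if "subspace U" for c U f g
  proof -
    show "(norm (of_real c * op_trace smul ip (orth_proj ip U \<circ> bracket smul ip f g)))\<^sup>2
      = (c * kre (ip (orth_proj ip U f) g))\<^sup>2"
      by (simp add: op_trace_orth_proj_bracket[OF that] norm_mult power_mult_distrib)
    have "of_real c * ip (orth_proj ip U g) f + of_real c * ip (orth_proj ip U f) g
        = of_real (c * (2 * kre (ip (orth_proj ip U f) g)))"
      by (simp only: ip_orth_proj_symmetrized[OF that] of_real_mult flip: distrib_left)
    then show "(norm (of_real c * ip (orth_proj ip U g) f
      + of_real c * ip (orth_proj ip U f) g))\<^sup>2 = 4 * (c * kre (ip (orth_proj ip U f) g))\<^sup>2"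
      by (simp only: norm_of_real power2_abs) (simp add: power_mult_distrib)
  qed
  have Q: "?Q f g \<sigma> = (\<Sum>i\<in>\<sigma>. ((v i)\<^sup>2 * kre (ip (orth_proj ip (V i) f) g))\<^sup>2)
      + (\<Sum>i\<in>{1..m} - \<sigma>. ((w i)\<^sup>2 * kre (ip (orth_proj ip (W i) f) g))\<^sup>2)"
    if "\<sigma> \<subseteq> {1..m}" for f g \<sigma>
    using that by (intro arg_cong2[of _ _ _ _ "(+)"] sum.cong tr_term V W) auto
  have L: "?L f g \<sigma> = ?Q f g \<sigma>" if "\<sigma> \<subseteq> {1..m}" for f g \<sigma>
  proof -
    have "(\<Sum>i\<in>\<sigma>. (norm (of_real ((v i)\<^sup>2) * ip (orth_proj ip (V i) g) f
          + of_real ((v i)\<^sup>2) * ip (orth_proj ip (V i) f) g))\<^sup>2)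
        = (\<Sum>i\<in>\<sigma>. 4 * ((v i)\<^sup>2 * kre (ip (orth_proj ip (V i) f) g))\<^sup>2)"
      using that by (intro sum.cong sym_term V) auto
    moreover have "(\<Sum>i\<in>{1..m} - \<sigma>. (norm (of_real ((w i)\<^sup>2) * ip (orth_proj ip (W i) g) f
          + of_real ((w i)\<^sup>2) * ip (orth_proj ip (W i) f) g))\<^sup>2)
        = (\<Sum>i\<in>{1..m} - \<sigma>. 4 * ((w i)\<^sup>2 * kre (ip (orth_proj ip (W i) f) g))\<^sup>2)"
      by (intro sum.cong sym_term W) auto
    ultimately show ?thesis
      unfolding Q[OF that] by (simp only: flip: sum_distrib_left) (simp add: distrib_left)
  qed
  have Q_nonneg: "0 \<le> ?Q f g \<sigma>" for f g \<sigma> by (intro add_nonneg_nonneg sum_nonneg) simp_all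
  have N_nonneg: "0 \<le> ?N f g" and N_0: "?N (x + y) (x - y) = 0 \<longleftrightarrow> (x, y) \<in> phase_rel smul"
    for f g x y
  proof -
    obtain x y where "f = x + y" "g = x - y" by (rule add_diff_decomp)
    then show "0 \<le> ?N f g" by (simp add: bracket_add_diff trace_norm_rank_one_diff_nonneg)
  next
    show "?N (x + y) (x - y) = 0 \<longleftrightarrow> (x, y) \<in> phase_rel smul"
      by (simp add: bracket_add_diff trace_norm_rank_one_diff_eq_0_iff rank_one_diff_eq_0_iff)
  qed
  have Q_0: "?Q (x + y) (x - y) \<sigma> = 0 \<longleftrightarrow>
      weave_meas ip m V v W w \<sigma> x = weave_meas ip m V v W w \<sigma> y"
    if \<sigma>: "\<sigma> \<subseteq> {1..m}" for x y \<sigma>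
  proof -
    have fin: "finite \<sigma>" using \<sigma> finite_subset by blast
    have "?Q (x + y) (x - y) \<sigma> = 0 \<longleftrightarrow>
        (\<forall>i\<in>\<sigma>. ((v i)\<^sup>2 * kre (ip (orth_proj ip (V i) (x + y)) (x - y)))\<^sup>2 = 0) \<and>
        (\<forall>i\<in>{1..m} - \<sigma>. ((w i)\<^sup>2 * kre (ip (orth_proj ip (W i) (x + y)) (x - y)))\<^sup>2 = 0)"
      unfolding Q[OF \<sigma>] using fin
      by (subst add_nonneg_eq_0_iff) (simp_all only: sum_nonneg zero_le_power2
          sum_nonneg_eq_0_iff finite_Diff finite_atLeastAtMost)
    also have "\<dots> \<longleftrightarrow>
        (\<forall>i\<in>\<sigma>. v i * nrm ip (orth_proj ip (V i) x) = v i * nrm ip (orth_proj ip (V i) y)) \<and>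
        (\<forall>i\<in>{1..m} - \<sigma>. w i * nrm ip (orth_proj ip (W i) x) = w i * nrm ip (orth_proj ip (W i) y))"
      unfolding weighted_norms_eq_iff[OF nrm_nonneg nrm_nonneg]
      using \<sigma> by (intro conj_cong ball_cong) (auto simp only: kre_ip_orth_proj_add_diff V W)
    also have "\<dots> \<longleftrightarrow> weave_meas ip m V v W w \<sigma> x = weave_meas ip m V v W w \<sigma> y"
    proof -
      have split: "(\<forall>i\<in>{1..m}. P i) \<longleftrightarrow> (\<forall>i\<in>\<sigma>. P i) \<and> (\<forall>i\<in>{1..m} - \<sigma>. P i)" for P
        using \<sigma> by blast
      have "restrict a {1..m} = restrict b {1..m} \<longleftrightarrow> (\<forall>i\<in>{1..m}. a i = b i)"
        for a b :: "nat \<Rightarrow> real"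
        by (auto simp: fun_eq_iff restrict_def)
      then show ?thesis unfolding weave_meas_def split by simp
    qed
    finally show ?thesis .
  qed
  have bound: "(\<exists>\<alpha>>0. q \<ge> \<alpha> * c) \<longleftrightarrow> (q = 0 \<longrightarrow> c = 0)" if "0 \<le> q" "0 \<le> c" for q c :: real
  proof
    assume "\<exists>\<alpha>>0. q \<ge> \<alpha> * c"
    then show "q = 0 \<longrightarrow> c = 0" using that by (auto simp: mult_le_0_iff)
  next
    assume *: "q = 0 \<longrightarrow> c = 0"
    show "\<exists>\<alpha>>0. q \<ge> \<alpha> * c"
    proof (cases "c = 0")
      case True
      then show ?thesis using that by (intro exI[of _ 1]) simp
    next
      case False
      \<comment> \<open>The witness \<open>q / c\<close> gives equality. It is positive because
        \<open>c\<close> nonzero forces \<open>q\<close> nonzero.\<close>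
      then show ?thesis using that * by (intro exI[of _ "q / c"]) auto
    qed
  qed
  define Q where "Q f g \<sigma> = ?Q f g \<sigma>" for f g \<sigma>
  define N where "N f g = ?N f g" for f g
  note Q_0 = Q_0[folded Q_def] and N_0 = N_0[folded N_def]
    and Q_nonneg = Q_nonneg[folded Q_def] and N_nonneg = N_nonneg[folded N_def]
  have "phase_retrievable_weaving smul ip m V v W w \<longleftrightarrow>
      (\<forall>\<sigma>\<subseteq>{1..m}. \<forall>x y. Q (x + y) (x - y) \<sigma> = 0 \<longrightarrow> N (x + y) (x - y) = 0)"
    by (simp only: phase_retrievable_weaving_def inj_on_weave_gamma_iff[OF V W] weaving N_0 Q_0
        simp_thms cong: imp_cong)
  \<comment> \<open>Every pair \<open>f\<close>, \<open>g\<close> has the form \<open>x + y\<close>,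
    \<open>x - y\<close>, so the two quantifications range over the same pairs.\<close>
  also have "\<dots> \<longleftrightarrow> (\<forall>f g. \<forall>\<sigma>\<subseteq>{1..m}. Q f g \<sigma> = 0 \<longrightarrow> N f g = 0)"
  proof (intro iffI allI impI)
    fix f g \<sigma>
    assume *: "\<forall>\<sigma>\<subseteq>{1..m}. \<forall>x y. Q (x + y) (x - y) \<sigma> = 0 \<longrightarrow> N (x + y) (x - y) = 0"
      and \<sigma>: "\<sigma> \<subseteq> {1..m}" and 0: "Q f g \<sigma> = 0"
    obtain x y where xy: "f = x + y" "g = x - y" by (rule add_diff_decomp)
    show "N f g = 0" using * \<sigma> 0 unfolding xy by blast
  qed blast
  also have "\<dots> \<longleftrightarrow>
      (\<forall>f g. \<forall>\<sigma>\<subseteq>{1..m}. \<exists>\<alpha>>0. ?L f g \<sigma> = ?Q f g \<sigma> \<and> ?Q f g \<sigma> \<ge> \<alpha> * ?N f g)"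
  proof (intro all_cong1 imp_cong refl)
    fix f g \<sigma> assume \<sigma>: "\<sigma> \<subseteq> {1..m}"
    show "(Q f g \<sigma> = 0 \<longrightarrow> N f g = 0) \<longleftrightarrow>
        (\<exists>\<alpha>>0. ?L f g \<sigma> = ?Q f g \<sigma> \<and> ?Q f g \<sigma> \<ge> \<alpha> * ?N f g)"
      unfolding bound[OF Q_nonneg N_nonneg, symmetric] L[OF \<sigma>] Q_def[symmetric] N_def[symmetric]
      by simp
  qed
  finally show ?thesis .
qed

end
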